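(* Let $n,t,d\ge 1$ be integers with $n>3t$. For $n$ clients with vectors in $\mathbb{R}^d$, up to $t$ of which are Byzantine, the best approximation ratio that can be achieved in the worst case by an aggregation algorithm satisfying weak validity is $1$: there exists an algorithm satisfying weak validity that computes a $1$-approximation of the centroid, and no algorithm satisfying weak validity computes an $\alpha$-approximation of the centroid with $\alpha<1$.
   Context: Model. There are $n$ clients, up to $t<n/3$ of which are Byzantine, and one trusted server. The server receives a family of $m$ vectors $(v_i)_{i\in M}$ in $\mathbb{R}^d$ (Euclidean norm and distance $\mathrm{dist}$), where $M\subseteq\{1,\dots,n\}$, $|M|=m$, $n-t\le m\le n$. An unknown set $N\subseteq M$ with $|N|\ge n-t$ is the set of non-faulty clients; the vectors of the clients in $M\setminus N$ are Byzantine and arbitrary. An aggregation algorithm $\mathcal{A}$ is a deterministic function of the received family only (it does not know $N$); its output is a vector in $\mathbb{R}^d$. A received family together with an admissible set $N$ is called a configuration. True centroid: $\mathrm{Cent}^\star=\frac1{|N|}\sum_{i\in N}v_i$. Candidate centroids: $S_{\mathrm{Cent}}$ is the set of all averages $\frac{1}{n-t}\sum_{i\in I}v_i$ with $I\subseteq M$, $|I|=n-t$. Let $\mathrm{Rad_{cov}}$ be the radius of the smallest closed Euclidean ball containing $S_{\mathrm{Cent}}$. Approximation: $\mathcal{A}$ computes an $\alpha$-approximation of the centroid if, in every configuration, its output $O$ satisfies $\mathrm{dist}(O,\mathrm{Cent}^\star)\le\alpha\cdot\mathrm{Rad_{cov}}$. Weak validity: whenever all $n$ clients are non-faulty ($N=M=\{1,\dots,n\}$)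 and all input vectors are equal to a single vector $v$, the output of $\mathcal{A}$ is $v$. *)

theory Defs
  imports "HOL-Analysis.Analysis"
begin

text \<open>A family \<open>(v\<^sub>i)\<^sub>i\<^sub>\<in>\<^sub>M\<close> is a partial map with domain \<open>M\<close>, so that an algorithm, being a function
  of such maps, sees exactly the received vectors and their senders, and not the set \<open>N\<close>.\<close>

type_synonym 'd family = "nat \<Rightarrow> (real ^ 'd) option"

type_synonym 'd algorithm = "'d family \<Rightarrow> real ^ 'd"

definition received_family :: "nat \<Rightarrow> nat \<Rightarrow> 'd::finite family \<Rightarrow> bool" where
  "received_family n t v \<longleftrightarrow>
     dom v \<subseteq> {1..n} \<and> n - t \<le> card (dom v) \<and> card (dom v) \<le> n"

definition configuration :: "nat \<Rightarrow> nat \<Rightarrow> 'd::finite family \<Rightarrow> nat set \<Rightarrow> bool" where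
  "configuration n t v N \<longleftrightarrow> received_family n t v \<and> N \<subseteq> dom v \<and> n - t \<le> card N"

definition average :: "'d::finite family \<Rightarrow> nat set \<Rightarrow> real ^ 'd" where
  "average v I = (1 / real (card I)) *\<^sub>R (\<Sum>i\<in>I. the (v i))"

definition true_centroid :: "'d::finite family \<Rightarrow> nat set \<Rightarrow> real ^ 'd" where
  "true_centroid v N = average v N"

definition candidate_centroids :: "nat \<Rightarrow> nat \<Rightarrow> 'd::finite family \<Rightarrow> (real ^ 'd) set" where
  "candidate_centroids n t v = {average v I | I. I \<subseteq> dom v \<and> card I = n - t}"

definition covering_radius :: "(real ^ 'd::finite) set \<Rightarrow> real" where
  "covering_radius S = (LEAST r. 0 \<le> r \<and> (\<exists>c. S \<subseteq> cball c r))"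

text \<open>\<open>LEAST\<close> on the reals is meaningful only if the minimum is attained; it is, for every
  nonempty bounded set.\<close>

lemma covering_radius_attained:
  fixes S :: "(real ^ 'd::finite) set"
  assumes "S \<noteq> {}" and "bounded S"
  shows "0 \<le> covering_radius S"
    and "\<exists>c. S \<subseteq> cball c (covering_radius S)"
    and "\<And>c r. S \<subseteq> cball c r \<Longrightarrow> covering_radius S \<le> r"
proof -
  define R where "R = {r::real. 0 \<le> r \<and> (\<exists>c. S \<subseteq> cball c r)}"
  obtain s where s: "s \<in> S" using assms by blast
  obtain c0 r0 where "S \<subseteq> cball c0 r0" using assms(2) bounded_subset_cball by blast
  moreover from this s have "0 \<le> r0"
    by (metis empty_iff cball_eq_empty not_less subsetD)
  ultimately have ne: "R \<noteq> {}" unfolding R_def by blast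
  have bdd: "bdd_below R" unfolding R_def by (rule bdd_belowI[of _ 0]) auto
  define \<rho> where "\<rho> = Inf R"
  have \<rho>0: "0 \<le> \<rho>" unfolding \<rho>_def using ne by (rule cInf_greatest) (auto simp: R_def)
  have "\<exists>c. S \<subseteq> cball c (\<rho> + 1 / real (Suc k))" for k
  proof -
    have "Inf R < \<rho> + 1 / real (Suc k)" by (simp add: \<rho>_def)
    then obtain r where "r \<in> R" "r < \<rho> + 1 / real (Suc k)"
      using cInf_lessD[OF ne] by blast
    then show ?thesis unfolding R_def by (auto 4 4 dest: subset_cball[OF less_imp_le])
  qed
  then obtain c where c: "\<And>k. S \<subseteq> cball (c k) (\<rho> + 1 / real (Suc k))" by metis
  have "c k \<in> cball s (\<rho> + 1)" for k
  proof -
    have "dist (c k) s \<le> \<rho> + 1 / real (Suc k)" using c s by (auto simp: subset_iff)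
    also have "\<dots> \<le> \<rho> + 1" by simp
    finally show ?thesis by (simp add: dist_commute)
  qed
  then obtain l f where f: "strict_mono (f :: nat \<Rightarrow> nat)" "(c \<circ> f) \<longlonglongrightarrow> l"
    using compact_cball[of s "\<rho> + 1"] unfolding compact_def by metis
  have lim: "(\<lambda>k. \<rho> + 1 / real (Suc (f k))) \<longlonglongrightarrow> \<rho> + 0"
    using LIMSEQ_subseq_LIMSEQ[OF LIMSEQ_inverse_real_of_nat f(1)]
    by (intro tendsto_intros) (simp add: o_def inverse_eq_divide)
  have "dist l x \<le> \<rho>" if "x \<in> S" for x
  proof -
    have "(\<lambda>k. dist ((c \<circ> f) k) x) \<longlonglongrightarrow> dist l x" using f(2) by (intro tendsto_intros)
    moreover have "dist ((c \<circ> f) k) x \<le> \<rho> + 1 / real (Suc (f k))" for k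
      using c that by (auto simp: subset_iff)
    ultimately show ?thesis using LIMSEQ_le[OF _ lim] by fastforce
  qed
  then have cov: "S \<subseteq> cball l \<rho>" by auto
  have low: "\<rho> \<le> r" if "S \<subseteq> cball c r" for c r
  proof -
    have "0 \<le> r" using that s by (metis empty_iff cball_eq_empty not_less subsetD)
    then show ?thesis unfolding \<rho>_def using that bdd by (intro cInf_lower) (auto simp: R_def)
  qed
  have eq: "covering_radius S = \<rho>" unfolding covering_radius_def
    by (rule Least_equality) (use \<rho>0 cov low in auto)
  show "0 \<le> covering_radius S" "\<exists>c. S \<subseteq> cball c (covering_radius S)"
    "\<And>c r. S \<subseteq> cball c r \<Longrightarrow> covering_radius S \<le> r"
    using eq \<rho>0 cov low by auto
qed

definition approximates_centroid ::
    "nat \<Rightarrow> nat \<Rightarrow> real \<Rightarrow> 'd::finite algorithm \<Rightarrow> bool" where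
  "approximates_centroid n t \<alpha> \<A> \<longleftrightarrow>
     (\<forall>v N. configuration n t v N \<longrightarrow>
        dist (\<A> v) (true_centroid v N) \<le> \<alpha> * covering_radius (candidate_centroids n t v))"

definition weakly_valid :: "nat \<Rightarrow> nat \<Rightarrow> 'd::finite algorithm \<Rightarrow> bool" where
  "weakly_valid n t \<A> \<longleftrightarrow>
     (\<forall>v N x. configuration n t v N \<and> N = {1..n} \<and> dom v = {1..n} \<and>
        (\<forall>i\<in>{1..n}. v i = Some x) \<longrightarrow> \<A> v = x)"

end

theory Submission imports Defs begin

text \<open>The optimal algorithm outputs a centre of the smallest ball covering the candidate centroids.
  The true centroid averages at least \<open>n - t\<close> vectors, hence is an average of candidates and lies
  in that ball by convexity. Conversely, every candidate centroid is the true centroid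
  of some configuration with the same received family, so an \<open>\<alpha>\<close>-approximation yields a covering ball
  of radius \<open>\<alpha> * Rad\<close>; by minimality of the covering radius \<open>\<alpha> \<ge> 1\<close> as soon as \<open>Rad > 0\<close>.\<close>

text \<open>Double counting: each index of \<open>N\<close> survives in all of the sets
  \<open>N - {j}\<close> except the one with \<open>j\<close> equal to it.\<close>

lemma sum_sum_remove1:
  fixes f :: "'a \<Rightarrow> 'b::real_vector"
  assumes "finite N"
  shows "(\<Sum>j\<in>N. sum f (N - {j})) = (real (card N) - 1) *\<^sub>R sum f N"
proof -
  have "(\<Sum>j\<in>N. sum f (N - {j})) = (\<Sum>j\<in>N. sum f N - f j)"
    using assms by (intro sum.cong) (simp_all add: sum_diff1)
  also have "\<dots> = (\<Sum>j\<in>N. sum f N) - sum f N"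
    by (rule sum_subtractf)
  also have "\<dots> = (real (card N) - 1) *\<^sub>R sum f N"
    by (simp only: sum_constant_scaleR scaleR_left_diff_distrib scaleR_one)
  finally show ?thesis .
qed

text \<open>With at least two indices, each \<open>N - {j}\<close> is nonempty and the factor
  \<open>card N - 1\<close> from the double count cancels the denominator of the smaller
  averages.\<close>

lemma average_eq_average_of_remove1:
  assumes "finite N" "card N \<ge> 2"
  shows "average v N = (\<Sum>j\<in>N. (1 / real (card N)) *\<^sub>R average v (N - {j}))"
proof -
  have "average v (N - {j}) = (1 / (real (card N) - 1)) *\<^sub>R (\<Sum>i\<in>N - {j}. the (v i))"
    if "j \<in> N" for j
    using that assms by (simp add: average_def)
  then have "(\<Sum>j\<in>N. (1 / real (card N)) *\<^sub>R average v (N - {j})) =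
      (1 / real (card N)) *\<^sub>R (1 / (real (card N) - 1)) *\<^sub>R (\<Sum>j\<in>N. \<Sum>i\<in>N - {j}. the (v i))"
    by (simp only: scaleR_sum_right cong: sum.cong)
  also have "\<dots> = average v N"
    unfolding sum_sum_remove1[OF assms(1)] average_def using assms(2) by simp
  finally show ?thesis ..
qed

text \<open>Induction on \<open>N\<close>: above size \<open>k\<close>, the average over
  \<open>N\<close> is the uniform convex combination of the averages over \<open>N\<close> with one
  index removed, and these lie in \<open>C\<close> by induction. The bound \<open>1 \<le> k\<close>
  ensures that no set of fewer than two indices is ever split.\<close>

lemma average_mem_convex:
  assumes "finite N" "1 \<le> k" "k \<le> card N" "convex C"
    and sub: "\<And>I. I \<subseteq> N \<Longrightarrow> card I = k \<Longrightarrow> average v I \<in> C"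
  shows "average v N \<in> C"
  using assms(1,3) sub
proof (induction N rule: finite_psubset_induct)
  case (psubset N)
  show ?case
  proof (cases "card N = k")
    case True
    then show ?thesis using psubset.prems(2) by blast
  next
    case False
    then have k: "k < card N" using psubset.prems(1) by simp
    then have "card N \<ge> 2" using assms(2) by simp
    have remove1: "average v (N - {j}) \<in> C" if "j \<in> N" for j
    proof (rule psubset.IH)
      show "N - {j} \<subset> N" using that by blast
      show "k \<le> card (N - {j})" using that k psubset.hyps by simp
      show "average v I \<in> C" if "I \<subseteq> N - {j}" "card I = k" for I
        using that psubset.prems(2) by blast
    qed
    have "(\<Sum>j\<in>N. (1 / real (card N)) *\<^sub>R average v (N - {j})) \<in> C"
    proof (rule convex_sum)
      show "(\<Sum>j\<in>N. 1 / real (card N)) = 1" using \<open>card N \<ge> 2\<close> by simp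
    qed (use psubset.hyps assms(4) remove1 in simp_all)
    then show ?thesis
      by (subst average_eq_average_of_remove1[OF psubset.hyps \<open>card N \<ge> 2\<close>])
  qed
qed

lemma average_const:
  assumes "\<And>i. i \<in> I \<Longrightarrow> v i = Some x" "card I \<noteq> 0"
  shows "average v I = x"
proof -
  have "(\<Sum>i\<in>I. the (v i)) = (\<Sum>i\<in>I. x)"
    using assms(1) by (intro sum.cong) simp_all
  also have "\<dots> = real (card I) *\<^sub>R x" by (rule sum_constant_scaleR)
  finally show ?thesis using assms(2) by (simp add: average_def)
qed

lemma received_family_finite_dom:
  assumes "received_family n t v"
  shows "finite (dom v)"
  using assms finite_subset unfolding received_family_def by blast

lemma candidate_centroids_nonempty:
  assumes "received_family n t v"
  shows "candidate_centroids n t v \<noteq> {}"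
proof -
  have "n - t \<le> card (dom v)" using assms by (simp add: received_family_def)
  then obtain I where "I \<subseteq> dom v" "card I = n - t" by (rule obtain_subset_with_card_n)
  then show ?thesis unfolding candidate_centroids_def by blast
qed

lemma finite_candidate_centroids:
  assumes "received_family n t v"
  shows "finite (candidate_centroids n t v)"
proof (rule finite_subset)
  show "candidate_centroids n t v \<subseteq> average v ` Pow (dom v)"
    unfolding candidate_centroids_def by blast
qed (simp add: received_family_finite_dom[OF assms])

text \<open>Nonemptiness and finiteness of the candidate set each require a received family, so
  later uses discharge the same premise twice.\<close>

lemmas covering_radius_candidates =
  covering_radius_attained[OF candidate_centroids_nonempty finite_imp_bounded[OF finite_candidate_centroids]]

text \<open>The choice by \<open>SOME\<close> depends on the received family alone, so this is a
  legitimate algorithm; for received families a centre exists because the minimal radius is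
  attained.\<close>

definition covering_center :: "nat \<Rightarrow> nat \<Rightarrow> 'd::finite algorithm" where
  "covering_center n t v =
     (SOME c. candidate_centroids n t v \<subseteq> cball c (covering_radius (candidate_centroids n t v)))"

lemma candidates_subset_cball_covering_center:
  assumes "received_family n t v"
  shows "candidate_centroids n t v \<subseteq>
    cball (covering_center n t v) (covering_radius (candidate_centroids n t v))"
  unfolding covering_center_def
  by (rule someI_ex, rule covering_radius_candidates(2)[OF assms assms])

lemma true_centroid_mem_cball_covering_center:
  assumes "t < n" "configuration n t v N"
  shows "true_centroid v N \<in>
    cball (covering_center n t v) (covering_radius (candidate_centroids n t v))"
  unfolding true_centroid_def
proof (rule average_mem_convex[where k = "n - t"])
  have rf: "received_family n t v" and N: "N \<subseteq> dom v" "n - t \<le> card N"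
    using assms(2) by (auto simp: configuration_def)
  show "finite N" using N(1) received_family_finite_dom[OF rf] by (rule finite_subset)
  show "average v I \<in> cball (covering_center n t v) (covering_radius (candidate_centroids n t v))"
    if "I \<subseteq> N" "card I = n - t" for I
    using that N candidates_subset_cball_covering_center[OF rf]
    unfolding candidate_centroids_def by blast
  show "n - t \<le> card N" by (fact N(2))
qed (use assms in auto)

lemma approximates_centroid_covering_center:
  assumes "t < n"
  shows "approximates_centroid n t 1 (covering_center n t)"
  using true_centroid_mem_cball_covering_center[OF assms]
  by (auto simp: approximates_centroid_def)

text \<open>Equal inputs make all candidates coincide, so the smallest covering ball degenerates to
  a point, which is its own centre.\<close>

lemma weakly_valid_covering_center:
  assumes "t < n"
  shows "weakly_valid n t (covering_center n t :: 'd::finite algorithm)"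
  unfolding weakly_valid_def
proof (intro allI impI, elim conjE)
  fix v :: "'d family" and N x
  assume conf: "configuration n t v N" and dom: "dom v = {1..n}"
    and const: "\<forall>i\<in>{1..n}. v i = Some x"
  have rf: "received_family n t v" using conf by (simp add: configuration_def)
  \<comment> \<open>Here \<open>t < n\<close> excludes averages over the empty set, whose default
    value is 0.\<close>
  have "candidate_centroids n t v \<subseteq> {x}"
    unfolding candidate_centroids_def using assms const dom by (auto intro!: average_const)
  then have S: "candidate_centroids n t v = {x}"
    using candidate_centroids_nonempty[OF rf] by blast
  have "covering_radius (candidate_centroids n t v) = 0"
    using covering_radius_candidates(1)[OF rf rf]
      covering_radius_candidates(3)[OF rf rf, of x 0] S by simp
  then show "covering_center n t v = x"
    using candidates_subset_cball_covering_center[OF rf] S by simp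
qed

lemma approximation_ratio_ge_1:
  fixes \<A> :: "'d::finite algorithm" and v :: "'d family"
  assumes approx: "approximates_centroid n t \<alpha> \<A>" and rf: "received_family n t v"
    and pos: "covering_radius (candidate_centroids n t v) > 0"
  shows "\<alpha> \<ge> 1"
proof -
  \<comment> \<open>The index set of any candidate is itself admissible as \<open>N\<close>, while
    the output \<open>\<A> v\<close> stays the same.\<close>
  have "candidate_centroids n t v \<subseteq> cball (\<A> v) (\<alpha> * covering_radius (candidate_centroids n t v))"
    using approx rf
    by (auto simp: candidate_centroids_def approximates_centroid_def configuration_def
        true_centroid_def)
  then have "covering_radius (candidate_centroids n t v)
      \<le> \<alpha> * covering_radius (candidate_centroids n t v)"
    by (rule covering_radius_candidates(3)[OF rf rf])
  then show ?thesis using pos by simp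
qed

lemma ex_family_covering_radius_pos:
  assumes "t \<ge> 1" "t < n"
  shows "\<exists>v :: 'd::finite family.
    received_family n t v \<and> covering_radius (candidate_centroids n t v) > 0"
proof -
  \<comment> \<open>Client 1 sends the all-ones vector and the others send 0. The blocks
    \<open>{1..n - t}\<close> and \<open>{t + 1..n}\<close> both have size \<open>n - t\<close>, but
    for \<open>t \<ge> 1\<close> only the first contains client 1, so their averages differ.\<close>
  define v :: "'d family"
    where "v i = (if i \<in> {1..n} then Some (if i = 1 then 1 else 0) else None)" for i
  have dom: "dom v = {1..n}" by (auto simp: v_def dom_def)
  have rf: "received_family n t v" by (simp add: received_family_def dom)
  have "(\<Sum>i\<in>{1..n - t}. the (v i)) = (\<Sum>i\<in>{1..n - t}. if i = 1 then 1 else 0)"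
    by (rule sum.cong) (auto simp: v_def)
  also have "\<dots> = 1" using assms by simp
  finally have "average v {1..n - t} \<noteq> 0" using assms by (simp add: average_def)
  moreover have "average v {t + 1..n} = 0"
    using assms by (intro average_const) (auto simp: v_def)
  moreover have "average v {1..n - t} \<in> candidate_centroids n t v"
    unfolding candidate_centroids_def dom by force
  moreover have "average v {t + 1..n} \<in> candidate_centroids n t v"
    unfolding candidate_centroids_def dom by force
  \<comment> \<open>Radius 0 would enclose two distinct candidates in a single point.\<close>
  ultimately have "\<not> candidate_centroids n t v \<subseteq> {c}" for c by (metis singletonD subsetD)
  then have "covering_radius (candidate_centroids n t v) \<noteq> 0"
    using covering_radius_candidates(2)[OF rf rf] by force
  then show ?thesis
    using rf covering_radius_candidates(1)[OF rf rf] by force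
qed

theorem lemma3p5:
  fixes n t :: nat
  assumes "n \<ge> 1" and "t \<ge> 1" and "n > 3 * t"
  shows "(\<exists>\<A> :: 'd::finite algorithm. weakly_valid n t \<A> \<and> approximates_centroid n t 1 \<A>) \<and>
    \<not> (\<exists>(\<A> :: 'd algorithm) \<alpha>. \<alpha> < 1 \<and> weakly_valid n t \<A> \<and> approximates_centroid n t \<alpha> \<A>)"
proof -
  have tn: "t < n" using assms by simp
  \<comment> \<open>The family is fixed before the algorithm: this one input refutes every ratio
    below 1.\<close>
  obtain v :: "'d family" where
    v: "received_family n t v" "covering_radius (candidate_centroids n t v) > 0"
    using ex_family_covering_radius_pos[OF assms(2) tn] by blast
  have "\<alpha> \<ge> 1" if "approximates_centroid n t \<alpha> \<A>" for \<alpha> and \<A> :: "'d algorithm"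
    using that v by (rule approximation_ratio_ge_1)
  then show ?thesis
    using weakly_valid_covering_center[OF tn] approximates_centroid_covering_center[OF tn]
    by (meson not_less)
qed

end
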